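(* Let $f(z)=\sum_{k=1}^N c_{\alpha_k}z^{\alpha_k}$ be a Laurent polynomial in $n$ variables with support $A=\{\alpha_1,\dots,\alpha_N\}\subset\mathbb{Z}^n$, whose Newton polytope has dimension $n$, and let $B$ be a dual matrix of $A$. Then there is a well-defined map \[ \operatorname{co-ord}\colon \operatorname{CC}(\overline{\mathcal{LA}'}(f)) \rightarrow \operatorname{int}(\mathcal{Z}_B)\cap\big(\operatorname{Arg}_\pi(c)B+2\pi\mathbb{Z}[B]\big), \] which for $\Theta\in\operatorname{CC}(\overline{\mathcal{LA}'}(f))$ is given by \[ \operatorname{co-ord}(\Theta)=v_\alpha(\theta),\qquad \theta\in\Theta,\ \alpha\in A. \] That is, $v_\alpha(\theta)$ lies in the stated target set and does not depend on the choice of $\theta\in\Theta$ nor on the choice of $\alpha\in A$.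
   Context: All coefficients $c_{\alpha_k}$ are nonzero complex numbers, the $\alpha_k$ are distinct, and $\mathbf{T}^n=(\mathbb{R}/2\pi\mathbb{Z})^n$. A half-space is a set $H_\phi=\{z\in\mathbb{C}\mid \Re(e^{i\phi}z)>0\}$, $\phi\in\mathbb{R}$. For $\theta\in\mathbf{T}^n$ put $f\langle\theta\rangle=[e^{i(\arg(c_{\alpha_1})+\langle\alpha_1,\theta\rangle)},\dots,e^{i(\arg(c_{\alpha_N})+\langle\alpha_N,\theta\rangle)}]$, also viewed as a subset of the unit circle. It is lopsided if there is a half-space $H$ with $f\langle\theta\rangle\subset\overline{H}$ but $f\langle\theta\rangle\not\subset\partial H$. The lopsided coamoeba $\mathcal{LA}'(f)$ is the set of $\theta\in\mathbf{T}^n$ such that $f\langle\theta\rangle$ is not lopsided; $\overline{\mathcal{LA}'}(f)$ is its closure, and $\operatorname{CC}(\overline{\mathcal{LA}'}(f))$ is the set of connected components of the complement of $\overline{\mathcal{LA}'}(f)$ in $\mathbf{T}^n$. The Newton polytope of $f$ is $\Delta_f=\operatorname{Conv}(A)$. Identify $A$ with the $(n+1)\times N$ integer matrix whose $k$th column is $(1,\alpha_k)^t$, and set $m=N-n-1$. A dual matrix of $A$ is an integer $N\times m$ matrix $B$ of full rank $m$ with $AB=0$; denote its rows by $b_1,\dots,b_N\in\mathbb{Z}^m$. $\mathbb{Z}[B]\subset\mathbb{Z}^m$ is the lattice generated by the rows of $B$, and $\mathcal{Z}_B=\{\sum_{j=1}^N\frac{\pi}{2}\mu_jb_j\mid |\mu_j|\le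 1\}\subset\mathbb{R}^m$. $\arg_\pi\colon\mathbb{C}^*\to(-\pi,\pi]$ is the principal argument, and $\operatorname{Arg}_\pi(c)=(\arg_\pi(c_{\alpha_1}),\dots,\arg_\pi(c_{\alpha_N}))$, a row vector. For $\alpha\in A$ and $\theta\in\mathbb{R}^n$ set \[ p_\alpha^k(\theta)=\arg_\pi\Big(\frac{c_{\alpha_k}e^{i\langle\alpha_k,\theta\rangle}}{c_\alpha e^{i\langle\alpha,\theta\rangle}}\Big)-\arg_\pi(c_{\alpha_k})+\arg_\pi(c_\alpha)-\langle\alpha_k-\alpha,\theta\rangle, \] $p_\alpha(\theta)=(p_\alpha^1(\theta),\dots,p_\alpha^N(\theta))$, and $v_\alpha(\theta)=(\operatorname{Arg}_\pi(c)+p_\alpha(\theta))B\in\mathbb{R}^m$. The function $v_\alpha$ is $2\pi$-periodic in each $\theta_i$, hence defined on $\mathbf{T}^n$. *)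

theory Defs
  imports "HOL-Analysis.Analysis" "HOL-Library.Poly_Mapping"
begin

section \<open>The torus\<close>

quotient_type angle = real / "\<lambda>x y. \<exists>k::int. y = x + 2 * pi * of_int k"
proof (rule equivpI)
  show "reflp (\<lambda>x y. \<exists>k::int. y = x + 2 * pi * of_int k)"
    by (auto intro!: reflpI exI[of _ 0])
  show "symp (\<lambda>x y. \<exists>k::int. y = x + 2 * pi * of_int k)"
  proof (rule sympI)
    fix x y :: real
    assume "\<exists>k::int. y = x + 2 * pi * of_int k"
    then obtain k :: int where "y = x + 2 * pi * of_int k" ..
    then have "x = y + 2 * pi * of_int (- k)" by simp
    then show "\<exists>k::int. x = y + 2 * pi * of_int k" ..
  qed
  show "transp (\<lambda>x y. \<exists>k::int. y = x + 2 * pi * of_int k)"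
  proof (rule transpI)
    fix x y z :: real
    assume "\<exists>k::int. y = x + 2 * pi * of_int k" "\<exists>k::int. z = y + 2 * pi * of_int k"
    then obtain k l :: int where "y = x + 2 * pi * of_int k" "z = y + 2 * pi * of_int l"
      by blast
    then have "z = x + 2 * pi * of_int (k + l)" by (simp add: algebra_simps)
    then show "\<exists>k::int. z = x + 2 * pi * of_int k" ..
  qed
qed

text \<open>The quotient topology. The torus is then the type \<open>angle ^ 'n\<close> with the library's
  product topology.\<close>

instantiation angle :: topological_space
begin

definition open_angle :: "angle set \<Rightarrow> bool"
  where "open_angle U \<longleftrightarrow> open (abs_angle -` U)"

instance
  by standard (auto simp: open_angle_def vimage_Union intro: open_Int open_UN)

end

definition torus_pt :: "real ^ 'n \<Rightarrow> angle ^ 'n"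
  where "torus_pt \<theta> = (\<chi> i. abs_angle (\<theta> $ i))"

section \<open>The lopsided coamoeba\<close>

text \<open>A Laurent polynomial in \<open>n\<close> variables is given by its finitely supported coefficient
  function \<open>f\<close>, so its support is \<open>keys f\<close>.\<close>

definition real_vec :: "int ^ 'n \<Rightarrow> real ^ 'n"
  where "real_vec a = (\<chi> i. real_of_int (a $ i))"

definition newton_polytope :: "((int ^ 'n) \<Rightarrow>\<^sub>0 complex) \<Rightarrow> (real ^ 'n) set"
  where "newton_polytope f = convex hull (real_vec ` Poly_Mapping.keys f)"

definition phases :: "((int ^ 'n) \<Rightarrow>\<^sub>0 complex) \<Rightarrow> real ^ 'n \<Rightarrow> complex set"
  where "phases f \<theta> =
    (\<lambda>a. cis (Arg (Poly_Mapping.lookup f a) + real_vec a \<bullet> \<theta>)) ` Poly_Mapping.keys f"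

lemma phases_cong:
  fixes x y :: "real ^ 'n"
  assumes "torus_pt x = torus_pt y"
  shows "phases f x = phases f y"
proof -
  have "\<forall>i. \<exists>k::int. y $ i = x $ i + 2 * pi * of_int k"
    using assms by (simp add: torus_pt_def vec_eq_iff angle.abs_eq_iff)
  then obtain k :: "'n \<Rightarrow> int" where k: "\<And>i. y $ i = x $ i + 2 * pi * of_int (k i)"
    by metis
  have "cis (t + real_vec a \<bullet> y) = cis (t + real_vec a \<bullet> x)" for t and a :: "int ^ 'n"
  proof -
    have "real_vec a \<bullet> y = real_vec a \<bullet> x + 2 * pi * of_int (\<Sum>i\<in>UNIV. a $ i * k i)"
      by (simp add: inner_vec_def real_vec_def k algebra_simps sum.distrib sum_distrib_left)
    then have "cis (t + real_vec a \<bullet> y)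
        = cis (t + real_vec a \<bullet> x) * cis (2 * pi * of_int (\<Sum>i\<in>UNIV. a $ i * k i))"
      by (simp add: cis_mult algebra_simps)
    also have "cis (2 * pi * of_int (\<Sum>i\<in>UNIV. a $ i * k i)) = 1"
      by (rule cis_multiple_2pi) (rule Ints_of_int)
    finally show ?thesis by simp
  qed
  then show ?thesis by (simp add: phases_def)
qed

definition half_space :: "real \<Rightarrow> complex set"
  where "half_space \<phi> = {z. Re (cis \<phi> * z) > 0}"

definition lopsided :: "complex set \<Rightarrow> bool"
  where "lopsided S \<longleftrightarrow>
    (\<exists>\<phi>. S \<subseteq> closure (half_space \<phi>) \<and> \<not> S \<subseteq> frontier (half_space \<phi>))"

text \<open>Taking the image under \<open>torus_pt\<close> is harmless by \<open>phases_cong\<close>.\<close>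

definition lopsided_coamoeba :: "((int ^ 'n) \<Rightarrow>\<^sub>0 complex) \<Rightarrow> (angle ^ 'n) set"
  where "lopsided_coamoeba f = torus_pt ` {\<theta>. \<not> lopsided (phases f \<theta>)}"

definition CC :: "((int ^ 'n) \<Rightarrow>\<^sub>0 complex) \<Rightarrow> (angle ^ 'n) set set"
  where "CC f = components (- closure (lopsided_coamoeba f))"

section \<open>Dual matrices\<close>

text \<open>In the following, \<open>\<alpha> :: 'k \<Rightarrow> int ^ 'n\<close> enumerates the support, with \<open>'k\<close> in the role of
  the index set \<open>{1..N}\<close>. The number \<open>m = N - n - 1\<close> may be 0, so it cannot be the
  cardinality of an index type. Vectors of \<open>\<real>\<^sup>m\<close> are therefore functions on \<open>nat\<close> that vanish
  from \<open>m\<close> on, as in \<^const>\<open>Euclidean_space\<close>, and an \<open>N \<times> m\<close> matrix is a function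
  \<open>B :: 'k \<Rightarrow> nat \<Rightarrow> int\<close> whose rows \<open>B k\<close> vanish from \<open>m\<close> on.\<close>

text \<open>The matrix with columns \<open>(1, \<alpha> k)\<close>; the row index \<open>None\<close> is that of the row of ones.\<close>

definition support_matrix :: "('k \<Rightarrow> int ^ 'n) \<Rightarrow> int ^ 'k ^ ('n option)"
  where "support_matrix \<alpha> = (\<chi> r k. case r of None \<Rightarrow> 1 | Some i \<Rightarrow> \<alpha> k $ i)"

definition codim :: "('k::finite \<Rightarrow> int ^ 'n) \<Rightarrow> nat"
  where "codim \<alpha> = CARD('k) - CARD('n) - 1"

definition dual_matrix :: "('k::finite \<Rightarrow> int ^ 'n) \<Rightarrow> ('k \<Rightarrow> nat \<Rightarrow> int) \<Rightarrow> bool"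
  where "dual_matrix \<alpha> B \<longleftrightarrow>
    (\<forall>k. \<forall>j\<ge>codim \<alpha>. B k j = 0) \<and>
    (\<forall>j<codim \<alpha>. support_matrix \<alpha> *v (\<chi> k. B k j) = 0) \<and>
    dim ((\<lambda>j. \<chi> k. real_of_int (B k j)) ` {..<codim \<alpha>} :: (real ^ 'k) set) = codim \<alpha>"

text \<open>The product of a row vector with \<open>B\<close>.\<close>

definition row_mult :: "('k::finite \<Rightarrow> real) \<Rightarrow> ('k \<Rightarrow> nat \<Rightarrow> int) \<Rightarrow> nat \<Rightarrow> real"
  where "row_mult x B = (\<lambda>j. \<Sum>k\<in>UNIV. x k * real_of_int (B k j))"

definition row_lattice :: "('k::finite \<Rightarrow> nat \<Rightarrow> int) \<Rightarrow> (nat \<Rightarrow> int) set"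
  where "row_lattice B = {(\<lambda>j. \<Sum>k\<in>UNIV. z k * B k j) | z. True}"

definition zonotope :: "('k::finite \<Rightarrow> nat \<Rightarrow> int) \<Rightarrow> (nat \<Rightarrow> real) set"
  where "zonotope B =
    {(\<lambda>j. \<Sum>k\<in>UNIV. pi / 2 * \<mu> k * real_of_int (B k j)) | \<mu>. \<forall>k. \<bar>\<mu> k\<bar> \<le> 1}"

section \<open>The order map\<close>

definition Arg_vec :: "((int ^ 'n) \<Rightarrow>\<^sub>0 complex) \<Rightarrow> ('k \<Rightarrow> int ^ 'n) \<Rightarrow> 'k \<Rightarrow> real"
  where "Arg_vec f \<alpha> = (\<lambda>k. Arg (Poly_Mapping.lookup f (\<alpha> k)))"

definition p_vec ::
  "((int ^ 'n) \<Rightarrow>\<^sub>0 complex) \<Rightarrow> ('k \<Rightarrow> int ^ 'n) \<Rightarrow> int ^ 'n \<Rightarrow> real ^ 'n \<Rightarrow> 'k \<Rightarrow> real"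
  where "p_vec f \<alpha> a \<theta> = (\<lambda>k.
    Arg ((Poly_Mapping.lookup f (\<alpha> k) * cis (real_vec (\<alpha> k) \<bullet> \<theta>)) /
         (Poly_Mapping.lookup f a * cis (real_vec a \<bullet> \<theta>)))
    - Arg (Poly_Mapping.lookup f (\<alpha> k)) + Arg (Poly_Mapping.lookup f a)
    - real_vec (\<alpha> k - a) \<bullet> \<theta>)"

definition v_vec ::
  "((int ^ 'n) \<Rightarrow>\<^sub>0 complex) \<Rightarrow> ('k::finite \<Rightarrow> int ^ 'n) \<Rightarrow> ('k \<Rightarrow> nat \<Rightarrow> int) \<Rightarrow>
    int ^ 'n \<Rightarrow> real ^ 'n \<Rightarrow> nat \<Rightarrow> real"
  where "v_vec f \<alpha> B a \<theta> = row_mult (\<lambda>k. Arg_vec f \<alpha> k + p_vec f \<alpha> a \<theta> k) B"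

definition shifted_lattice ::
  "((int ^ 'n) \<Rightarrow>\<^sub>0 complex) \<Rightarrow> ('k::finite \<Rightarrow> int ^ 'n) \<Rightarrow> ('k \<Rightarrow> nat \<Rightarrow> int) \<Rightarrow>
    (nat \<Rightarrow> real) set"
  where "shifted_lattice f \<alpha> B =
    {(\<lambda>j. row_mult (Arg_vec f \<alpha>) B j + 2 * pi * real_of_int (l j)) | l. l \<in> row_lattice B}"

end

theory Submission
  imports Defs
begin

text \<open>Since the rows of \<open>B\<close> sum to 0 and \<open>A B = 0\<close>, the vector \<open>v\<^sub>a(\<theta>)\<close> equals
  \<open>\<Sum>\<^sub>k Arg (w\<^sub>k / w\<^sub>a) b\<^sub>k\<close>, where \<open>w\<^sub>k\<close> is the value of the \<open>k\<close>-th term of \<open>f\<close>. Off the closed lopsided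
  coamoeba no two phases are antipodal, because a small move of \<open>\<theta>\<close> would then destroy
  lopsidedness. Hence some rotation by \<open>u\<close> brings all terms into the open right half-plane, where
  \<open>Arg (w\<^sub>k / w\<^sub>a) = Arg (u w\<^sub>k) - Arg (u w\<^sub>a)\<close>. The second summand is killed by \<open>B\<close>, which gives
  independence of \<open>a\<close>, and \<open>\<bar>Arg (u w\<^sub>k)\<bar> < \<pi>/2\<close> together with the full rank of \<open>B\<close> gives an
  interior point of the zonotope. Finally \<open>p\<^sub>a\<close> takes values in \<open>2\<pi>\<int>\<close> and is continuous there, so
  \<open>v\<^sub>a\<close> is locally constant.\<close>

section \<open>Lopsidedness\<close>

lemma Re_mult_eq_inner: "Re (u * z) = cnj u \<bullet> z"
  by (simp add: inner_complex_def)

lemma half_space_eq_inner: "half_space \<phi> = {z. cnj (cis \<phi>) \<bullet> z > 0}"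
  by (simp only: half_space_def Re_mult_eq_inner)

lemma lopsided_iff:
  "lopsided S \<longleftrightarrow>
    (\<exists>\<phi>. (\<forall>z\<in>S. Re (cis \<phi> * z) \<ge> 0) \<and> (\<exists>z\<in>S. Re (cis \<phi> * z) \<noteq> 0))"
proof -
  have "cnj (cis \<phi>) \<noteq> 0" for \<phi>
    by simp
  then have "closure (half_space \<phi>) = {z. Re (cis \<phi> * z) \<ge> 0}"
    and "frontier (half_space \<phi>) = {z. Re (cis \<phi> * z) = 0}" for \<phi>
    unfolding half_space_eq_inner Re_mult_eq_inner
    by (simp_all add: closure_halfspace_gt frontier_halfspace_gt del: cis_cnj complex_cnj_zero_iff)
  then show ?thesis
    by (auto simp: lopsided_def subset_iff)
qed

text \<open>\<open>Im (cnj x * y)\<close> is the determinant of the real \<open>2 \<times> 2\<close> matrix with columns \<open>x\<close> and \<open>y\<close>,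
  so the hypotheses say that 0 lies in the interior of the triangle with vertices \<open>x\<close>, \<open>y\<close>, \<open>z\<close>.\<close>

lemma not_lopsided_if_surrounding:
  assumes "x \<in> S" "y \<in> S" "z \<in> S"
    and xy: "Im (cnj x * y) > 0" and yz: "Im (cnj y * z) > 0" and zx: "Im (cnj z * x) > 0"
  shows "\<not> lopsided S"
proof
  assume "lopsided S"
  then obtain \<phi> where \<phi>: "\<And>w. w \<in> S \<Longrightarrow> Re (cis \<phi> * w) \<ge> 0"
    unfolding lopsided_iff by blast
  define u where "u = cis \<phi>"
  have ge: "Re (u * x) \<ge> 0" "Re (u * y) \<ge> 0" "Re (u * z) \<ge> 0"
    using \<phi> assms(1-3) by (auto simp: u_def)
  \<comment> \<open>The linear relation between three plane vectors given by their pairwise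
    determinants. Its coefficients are positive, so each of the three nonnegative terms is
    0.\<close>
  have "Im (cnj y * z) * Re (u * x) + Im (cnj z * x) * Re (u * y) + Im (cnj x * y) * Re (u * z) = 0"
    by (simp add: algebra_simps)
  moreover have "Im (cnj y * z) * Re (u * x) \<ge> 0" "Im (cnj z * x) * Re (u * y) \<ge> 0"
    "Im (cnj x * y) * Re (u * z) \<ge> 0"
    using ge xy yz zx by (auto intro!: mult_nonneg_nonneg simp del: times_complex.sel)
  ultimately have "Im (cnj y * z) * Re (u * x) = 0" "Im (cnj z * x) * Re (u * y) = 0"
    by linarith+
  then have "Re (u * x) = 0" "Re (u * y) = 0"
    using yz zx by (metis less_irrefl mult_eq_0_iff)+
  \<comment> \<open>Cramer's rule: the two equations are a linear system in \<open>Re u\<close> and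
    \<open>Im u\<close> with determinant \<open>Im (cnj x * y)\<close> up to sign.\<close>
  then have "Re u * Im (cnj x * y) = 0" "Im u * Im (cnj x * y) = 0"
    by (simp, algebra)+
  then have "u = 0"
    using xy by (metis complex_eqI less_irrefl mult_eq_0_iff zero_complex.sel)
  then show False
    by (simp add: u_def)
qed

text \<open>After rotation by \<open>\<phi>\<close> only \<open>\<i>\<close> and
  \<open>- \<i>\<close> can lie on the boundary line, and without antipodal pairs at most one of
  them occurs. A slight further rotation brings it inside, while the finitely many other points stay
  inside by continuity.\<close>

lemma lopsided_imp_open_half_plane:
  assumes "finite S" "lopsided S" and unit: "\<And>z. z \<in> S \<Longrightarrow> norm z = 1"
    and antipodal: "\<And>z. z \<in> S \<Longrightarrow> - z \<notin> S"
  obtains u where "\<And>z. z \<in> S \<Longrightarrow> Re (u * z) > 0"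
proof -
  obtain \<phi> where \<phi>: "\<And>z. z \<in> S \<Longrightarrow> Re (cis \<phi> * z) \<ge> 0"
    using assms(2) unfolding lopsided_iff by blast
  have boundary: "cis \<phi> * z = \<i> \<or> cis \<phi> * z = - \<i>" if "z \<in> S" "Re (cis \<phi> * z) = 0" for z
  proof -
    have "norm (cis \<phi> * z) = 1"
      using unit[OF that(1)] by (simp add: norm_mult)
    then have "\<bar>Im (cis \<phi> * z)\<bar> = 1"
      using that(2) by (metis cmod_eq_Im)
    then show ?thesis
      using that(2) by (auto simp: complex_eq_iff abs_if split: if_splits)
  qed
  \<comment> \<open>\<open>\<sigma>\<close> is the side of the boundary point; -1 also serves when
    there is none.\<close>
  obtain \<sigma> :: real where \<sigma>: "\<And>z. z \<in> S \<Longrightarrow> Re (cis \<phi> * z) = 0 \<Longrightarrow> \<sigma> * Im (cis \<phi> * z) > 0"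
  proof (cases "\<exists>z\<in>S. cis \<phi> * z = \<i>")
    case True
    then obtain z where z: "z \<in> S" "cis \<phi> * z = \<i>" by blast
    have "cis \<phi> * w \<noteq> - \<i>" if "w \<in> S" for w
    proof
      assume "cis \<phi> * w = - \<i>"
      then have "cis \<phi> * w = cis \<phi> * (- z)" using z by simp
      then have "w = - z" using mult_left_cancel[of "cis \<phi>" w "- z"] by simp
      with antipodal[OF z(1)] that show False by simp
    qed
    then show ?thesis
      using boundary by (intro that[of 1]) (fastforce simp del: times_complex.sel)
  next
    case False
    then show ?thesis
      using boundary by (intro that[of "-1"]) (fastforce simp del: times_complex.sel)
  qed
  \<comment> \<open>The factor \<open>1 - \<i> * complex_of_real (s * \<sigma>)\<close> is to first
    order a rotation by \<open>- s * \<sigma>\<close>; its modulus does not affect signs.\<close>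
  have ev: "\<forall>\<^sub>F s in at_right 0. Re ((1 - \<i> * complex_of_real (s * \<sigma>)) * cis \<phi> * z) > 0"
    if "z \<in> S" for z
  proof -
    have eq: "Re ((1 - \<i> * complex_of_real (s * \<sigma>)) * cis \<phi> * z)
        = Re (cis \<phi> * z) + s * (\<sigma> * Im (cis \<phi> * z))" for s
      by (simp add: algebra_simps)
    show ?thesis
    proof (cases "Re (cis \<phi> * z) = 0")
      case True
      show ?thesis
        unfolding eq True using \<sigma>[OF that True]
        by (intro eventually_at_rightI[of 0 1]) (simp_all del: times_complex.sel)
    next
      case False
      then have "Re (cis \<phi> * z) > 0" using \<phi>[OF that] by simp
      moreover have "((\<lambda>s. Re (cis \<phi> * z) + s * (\<sigma> * Im (cis \<phi> * z)))
          \<longlongrightarrow> Re (cis \<phi> * z) + 0 * (\<sigma> * Im (cis \<phi> * z))) (at_right 0)"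
        by (intro tendsto_intros)
      ultimately show ?thesis
        unfolding eq by (intro order_tendstoD(1)) (simp_all del: times_complex.sel)
    qed
  qed
  have "\<forall>\<^sub>F s in at_right 0. \<forall>z\<in>S. Re ((1 - \<i> * complex_of_real (s * \<sigma>)) * cis \<phi> * z) > 0"
    by (intro eventually_ball_finite[OF assms(1)] ballI ev)
  from eventually_happens'[OF trivial_limit_at_right_real this]
  obtain s where "\<forall>z\<in>S. Re ((1 - \<i> * complex_of_real (s * \<sigma>)) * cis \<phi> * z) > 0"
    ..
  then show thesis
    by (blast intro: that)
qed

text \<open>Both arguments have modulus below \<open>pi / 2\<close>, so their difference stays in
  the principal range.\<close>

lemma Arg_divide_Re_pos:
  assumes "Re x > 0" "Re y > 0"
  shows "Arg (x / y) = Arg x - Arg y"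
proof (rule cis_Arg_unique)
  have [simp]: "x \<noteq> 0" "y \<noteq> 0" using assms by auto
  show "sgn (x / y) = cis (Arg x - Arg y)"
    by (simp add: sgn_divide cis_Arg flip: cis_divide)
  have "\<bar>Arg x\<bar> < pi / 2" "\<bar>Arg y\<bar> < pi / 2"
    using assms by (simp_all only: Arg_eq_Im_Ln Re_Ln_pos_lt \<open>x \<noteq> 0\<close> \<open>y \<noteq> 0\<close> not_False_eq_True)
  then show "- pi < Arg x - Arg y" "Arg x - Arg y \<le> pi"
    by linarith+
qed

section \<open>The torus\<close>

lemma surj_torus_pt: "surj (torus_pt :: real ^ 'n \<Rightarrow> angle ^ 'n)"
proof (rule surjI)
  show "torus_pt (\<chi> i. rep_angle (x $ i)) = x" for x :: "angle ^ 'n"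
    by (simp add: torus_pt_def vec_eq_iff Quotient_abs_rep[OF Quotient_angle])
qed

lemma continuous_on_torus_pt: "continuous_on UNIV torus_pt"
proof -
  have "continuous_on UNIV abs_angle"
    by (simp add: continuous_on_open_vimage open_angle_def)
  then have "continuous_on UNIV (\<lambda>\<theta> :: real ^ 'n. abs_angle (\<theta> $ i))" for i
    by (rule continuous_on_compose2) (auto intro: continuous_intros)
  then show ?thesis
    unfolding torus_pt_def by (intro continuous_on_vec_lambda)
qed

text \<open>The saturation of \<open>U\<close> is the union of its translates by multiples of
  \<open>2 * pi\<close>.\<close>

lemma open_image_abs_angle:
  assumes "open U"
  shows "open (abs_angle ` U)"
proof -
  have "abs_angle -` (abs_angle ` U) = (\<Union>k::int. (\<lambda>x. x + 2 * pi * of_int k) -` U)"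
  proof (rule set_eqI)
    fix x
    have "x \<in> abs_angle -` (abs_angle ` U) \<longleftrightarrow> (\<exists>y\<in>U. \<exists>k::int. y = x + 2 * pi * of_int k)"
      by (simp add: image_iff angle.abs_eq_iff)
    then show "x \<in> abs_angle -` (abs_angle ` U) \<longleftrightarrow>
        x \<in> (\<Union>k::int. (\<lambda>x. x + 2 * pi * of_int k) -` U)"
      by auto
  qed
  moreover have "open ((\<lambda>x. x + 2 * pi * of_int k) -` U)" for k :: int
    using assms by (intro open_vimage continuous_intros)
  ultimately show ?thesis
    by (simp add: open_angle_def open_UN)
qed

text \<open>Points of the torus lift coordinate by coordinate, so an open box maps onto the product
  of the images of its sides. This transfers local constancy from \<open>real ^ 'n\<close> to the
  torus.\<close>

lemma open_image_torus_pt: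
  assumes "open U"
  shows "open (torus_pt ` U)"
  unfolding open_vec_def
proof
  fix x assume "x \<in> torus_pt ` U"
  then obtain \<theta> where \<theta>: "\<theta> \<in> U" "x = torus_pt \<theta>" by blast
  then obtain V where V: "\<And>i. open (V i)" "\<And>i. \<theta> $ i \<in> V i" "\<And>y. (\<And>i. y $ i \<in> V i) \<Longrightarrow> y \<in> U"
    using assms unfolding open_vec_def by metis
  have "y \<in> torus_pt ` U" if y: "\<And>i. y $ i \<in> abs_angle ` V i" for y
  proof -
    obtain t where t: "\<And>i. t i \<in> V i" "\<And>i. y $ i = abs_angle (t i)"
      using y unfolding image_iff by metis
    have "y = torus_pt (\<chi> i. t i)"
      using t(2) by (simp add: torus_pt_def vec_eq_iff)
    moreover have "(\<chi> i. t i) \<in> U"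
      using t(1) by (intro V(3)) simp
    ultimately show ?thesis by blast
  qed
  moreover have "open (abs_angle ` V i)" "x $ i \<in> abs_angle ` V i" for i
    using V(1,2) \<theta>(2) by (auto simp: torus_pt_def open_image_abs_angle)
  ultimately show "\<exists>A. (\<forall>i. open (A i) \<and> x $ i \<in> A i) \<and>
      (\<forall>y. (\<forall>i. y $ i \<in> A i) \<longrightarrow> y \<in> torus_pt ` U)"
    by (intro exI[of _ "\<lambda>i. abs_angle ` V i"]) blast
qed

lemma cis_inner_torus_pt_cong:
  fixes x y :: "real ^ 'n"
  assumes "torus_pt x = torus_pt y"
  shows "cis (real_vec a \<bullet> x) = cis (real_vec a \<bullet> y)"
proof -
  have "\<forall>i. \<exists>k::int. y $ i = x $ i + 2 * pi * of_int k"
    using assms by (simp add: torus_pt_def vec_eq_iff angle.abs_eq_iff)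
  then obtain k :: "'n \<Rightarrow> int" where k: "\<And>i. y $ i = x $ i + 2 * pi * of_int (k i)"
    by metis
  have "real_vec a \<bullet> y = real_vec a \<bullet> x + 2 * pi * of_int (\<Sum>i\<in>UNIV. a $ i * k i)"
    by (simp add: inner_vec_def real_vec_def k algebra_simps sum.distrib sum_distrib_left)
  then have "cis (real_vec a \<bullet> y)
      = cis (real_vec a \<bullet> x) * cis (2 * pi * of_int (\<Sum>i\<in>UNIV. a $ i * k i))"
    by (simp add: cis_mult)
  also have "cis (2 * pi * of_int (\<Sum>i\<in>UNIV. a $ i * k i)) = 1"
    by (rule cis_multiple_2pi) (rule Ints_of_int)
  finally show ?thesis by simp
qed

section \<open>Phases off the closed lopsided coamoeba\<close>

text \<open>The term of \<open>f\<close> with exponent \<open>a\<close> at the point with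
  coordinates \<open>cis (\<theta> $ i)\<close>.\<close>

definition term_value :: "((int ^ 'n) \<Rightarrow>\<^sub>0 complex) \<Rightarrow> int ^ 'n \<Rightarrow> real ^ 'n \<Rightarrow> complex"
  where "term_value f a \<theta> = Poly_Mapping.lookup f a * cis (real_vec a \<bullet> \<theta>)"

lemma term_value_nonzero: "a \<in> Poly_Mapping.keys f \<Longrightarrow> term_value f a \<theta> \<noteq> 0"
  by (simp add: term_value_def in_keys_iff)

lemma term_value_cong: "torus_pt x = torus_pt y \<Longrightarrow> term_value f a x = term_value f a y"
  unfolding term_value_def by (metis cis_inner_torus_pt_cong)

lemma sgn_term_value:
  "a \<in> Poly_Mapping.keys f \<Longrightarrow>
    sgn (term_value f a \<theta>) = cis (Arg (Poly_Mapping.lookup f a) + real_vec a \<bullet> \<theta>)"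
  by (simp add: term_value_def sgn_mult cis_Arg in_keys_iff flip: cis_mult)

lemma phases_eq: "phases f \<theta> = (\<lambda>a. sgn (term_value f a \<theta>)) ` Poly_Mapping.keys f"
  unfolding phases_def by (intro image_cong refl) (simp add: sgn_term_value)

lemma continuous_term_value: "isCont (term_value f a) \<theta>"
  unfolding term_value_def cis_conv_exp by (intro continuous_intros)

lemma sgn_term_value_shift:
  "sgn (term_value f a (\<theta> + s *\<^sub>R \<delta>)) = sgn (term_value f a \<theta>) * cis (s * (real_vec a \<bullet> \<delta>))"
  by (simp add: term_value_def sgn_mult inner_add_right mult.assoc cis_mult)

lemma open_lopsided_region:
  "open (torus_pt -` (- closure (lopsided_coamoeba f)))"
  using continuous_on_torus_pt by (auto intro: open_vimage)

lemma lopsided_region_lopsided: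
  assumes "torus_pt \<theta> \<notin> closure (lopsided_coamoeba f)"
  shows "lopsided (phases f \<theta>)"
proof (rule ccontr)
  assume "\<not> lopsided (phases f \<theta>)"
  then have "torus_pt \<theta> \<in> lopsided_coamoeba f"
    by (simp add: lopsided_coamoeba_def)
  then show False
    using assms closure_subset by blast
qed

text \<open>Moving \<open>\<theta>\<close> along \<open>\<delta> = a - b\<close> turns the phase of \<open>a\<close> relative to that of \<open>b\<close> at the positive
  speed \<open>\<delta> \<bullet> \<delta>\<close>, so that the three phases of \<open>a\<close>, \<open>b\<close>, \<open>c\<close> immediately surround the origin.\<close>

lemma no_antipodal_oriented:
  assumes \<theta>: "torus_pt \<theta> \<notin> closure (lopsided_coamoeba f)"
    and keys: "a \<in> Poly_Mapping.keys f" "b \<in> Poly_Mapping.keys f" "c \<in> Poly_Mapping.keys f"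
    and antipodal: "sgn (term_value f b \<theta>) = - sgn (term_value f a \<theta>)"
    and orient: "Im (cnj (sgn (term_value f b \<theta>)) * sgn (term_value f c \<theta>)) > 0"
  shows False
proof -
  define \<delta> where "\<delta> = real_vec a - real_vec b"
  define e where "e x s = sgn (term_value f x (\<theta> + s *\<^sub>R \<delta>))" for x s
  have e: "e x s = sgn (term_value f x \<theta>) * cis (s * (real_vec x \<bullet> \<delta>))" for x s
    by (simp add: e_def sgn_term_value_shift)
  have e_cont: "isCont (\<lambda>s. e x s) 0" for x
    unfolding e cis_conv_exp by (intro continuous_intros)
  have "a \<noteq> b"
    using antipodal term_value_nonzero[OF keys(1)] by (auto simp: sgn_zero_iff)
  then have "\<delta> \<noteq> 0"
    by (auto simp: \<delta>_def real_vec_def vec_eq_iff)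
  then have D: "\<delta> \<bullet> \<delta> > 0" by simp
  have "\<forall>\<^sub>F s in at_right 0. Im (cnj (e a s) * e b s) > 0"
  proof -
    \<comment> \<open>This determinant vanishes at \<open>s = 0\<close>, where the two phases are
      antipodal, so continuity cannot give its sign and it is computed exactly.\<close>
    have "Im (cnj (e a s) * e b s) = sin (s * (\<delta> \<bullet> \<delta>))" for s
    proof -
      have "cnj (sgn (term_value f a \<theta>)) * sgn (term_value f a \<theta>) = 1"
        using complex_norm_square[of "sgn (term_value f a \<theta>)"] term_value_nonzero[OF keys(1)]
        by (simp add: norm_sgn mult.commute)
      then have "cnj (e a s) * e b s
          = - (cnj (cis (s * (real_vec a \<bullet> \<delta>))) * cis (s * (real_vec b \<bullet> \<delta>)))"
        unfolding e antipodal by (simp add: algebra_simps flip: cis_cnj)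
      also have "\<dots> = - cis (- (s * (\<delta> \<bullet> \<delta>)))"
        by (simp add: cis_cnj cis_mult \<delta>_def inner_diff_left algebra_simps)
      finally show ?thesis by simp
    qed
    moreover have "\<forall>\<^sub>F s in at_right 0. sin (s * (\<delta> \<bullet> \<delta>)) > 0"
      using D by (intro eventually_at_rightI[of 0 "pi / (\<delta> \<bullet> \<delta>)"] sin_gt_zero)
        (simp_all add: field_simps)
    ultimately show ?thesis by simp
  qed
  moreover have "\<forall>\<^sub>F s in at_right 0. Im (cnj (e b s) * e c s) > 0"
  proof -
    have "isCont (\<lambda>s. Im (cnj (e b s) * e c s)) 0"
      by (intro isCont_Im isCont_mult isCont_cnj e_cont)
    moreover have "Im (cnj (e b 0) * e c 0) > 0"
      using orient by (simp add: e)
    ultimately show ?thesis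
      unfolding isCont_def using order_tendstoD(1) filterlim_at_split by blast
  qed
  moreover have "\<forall>\<^sub>F s in at_right 0. Im (cnj (e c s) * e a s) > 0"
  proof -
    have "isCont (\<lambda>s. Im (cnj (e c s) * e a s)) 0"
      by (intro isCont_Im isCont_mult isCont_cnj e_cont)
    \<comment> \<open>At \<open>s = 0\<close> the phase of \<open>a\<close> is minus that of
      \<open>b\<close>, so this determinant equals the one in \<open>orient\<close>.\<close>
    moreover have "Im (cnj (e c 0) * e a 0) > 0"
      using orient unfolding e antipodal by (simp add: algebra_simps)
    ultimately show ?thesis
      unfolding isCont_def using order_tendstoD(1) filterlim_at_split by blast
  qed
  moreover have "\<forall>\<^sub>F s in at_right 0. torus_pt (\<theta> + s *\<^sub>R \<delta>) \<in> - closure (lopsided_coamoeba f)"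
  proof -
    have "((\<lambda>s. \<theta> + s *\<^sub>R \<delta>) \<longlongrightarrow> \<theta> + 0 *\<^sub>R \<delta>) (at_right 0)"
      by (intro tendsto_intros)
    then show ?thesis
      using topological_tendstoD[OF _ open_lopsided_region[of f]] \<theta> by fastforce
  qed
  ultimately have "\<forall>\<^sub>F s::real in at_right 0. False"
  proof eventually_elim
    case (elim s)
    have "\<not> lopsided (phases f (\<theta> + s *\<^sub>R \<delta>))"
      using elim(1-3) keys
      by (intro not_lopsided_if_surrounding[of "e a s" _ "e b s" "e c s"])
        (auto simp: phases_eq e_def simp del: times_complex.sel)
    then show False
      using lopsided_region_lopsided elim(4) by blast
  qed
  then show False by simp
qed

text \<open>An antipodal pair in a closed half-plane lies on its boundary line, and lopsidedness
  supplies a third phase off that line. The oriented case applies after exchanging \<open>a\<close>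
  and \<open>b\<close> if necessary.\<close>

lemma no_antipodal:
  assumes \<theta>: "torus_pt \<theta> \<notin> closure (lopsided_coamoeba f)"
    and keys: "a \<in> Poly_Mapping.keys f" "b \<in> Poly_Mapping.keys f"
  shows "sgn (term_value f b \<theta>) \<noteq> - sgn (term_value f a \<theta>)"
proof
  define e where "e x = sgn (term_value f x \<theta>)" for x
  assume "sgn (term_value f b \<theta>) = - sgn (term_value f a \<theta>)"
  then have ab: "e b = - e a" by (simp add: e_def)
  obtain \<phi> c where \<phi>: "\<And>x. x \<in> Poly_Mapping.keys f \<Longrightarrow> Re (cis \<phi> * e x) \<ge> 0"
    and c: "c \<in> Poly_Mapping.keys f" "Re (cis \<phi> * e c) \<noteq> 0"
    using lopsided_region_lopsided[OF \<theta>] unfolding lopsided_iff phases_eq e_def by blast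
  have b0: "Re (cis \<phi> * e b) = 0"
    using \<phi>[OF keys(1)] \<phi>[OF keys(2)] ab by simp
  \<comment> \<open>Otherwise \<open>e c\<close> would be a real multiple of \<open>e b\<close> and
    lie on the boundary line too.\<close>
  have "Im (cnj (e b) * e c) \<noteq> 0"
  proof
    assume "Im (cnj (e b) * e c) = 0"
    then have "cnj (e b) * e c = of_real (Re (cnj (e b) * e c))"
      by (simp add: complex_eq_iff)
    moreover have "e b * cnj (e b) = 1"
      using complex_norm_square[of "e b"] term_value_nonzero[OF keys(2)]
      by (simp add: norm_sgn e_def)
    ultimately have "e c = of_real (Re (cnj (e b) * e c)) * e b"
      by (metis mult.assoc mult.commute mult_1)
    then have "cis \<phi> * e c = of_real (Re (cnj (e b) * e c)) * (cis \<phi> * e b)"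
      by (metis mult.left_commute)
    then show False
      using c(2) b0 by (metis Re_complex_of_real Im_complex_of_real times_complex.sel(1)
          mult_zero_left mult_zero_right diff_zero)
  qed
  then consider "Im (cnj (e b) * e c) > 0" | "Im (cnj (e a) * e c) > 0"
    using ab by fastforce
  then show False
    using no_antipodal_oriented[OF \<theta> keys c(1)] no_antipodal_oriented[OF \<theta> keys(2,1) c(1)] ab
    unfolding e_def by cases auto
qed

text \<open>The phases lie in an open half-plane because they are lopsided without antipodal pairs;
  term values are positive multiples of them.\<close>

lemma open_half_plane:
  assumes "torus_pt \<theta> \<notin> closure (lopsided_coamoeba f)"
  obtains u where "\<And>a. a \<in> Poly_Mapping.keys f \<Longrightarrow> Re (u * term_value f a \<theta>) > 0"
proof -
  obtain u where u: "\<And>z. z \<in> phases f \<theta> \<Longrightarrow> Re (u * z) > 0"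
  proof (rule lopsided_imp_open_half_plane[OF _ lopsided_region_lopsided[OF assms]])
    show "finite (phases f \<theta>)"
      by (simp add: phases_def)
    show "norm z = 1" if "z \<in> phases f \<theta>" for z
      using that by (auto simp: phases_def)
    show "- z \<notin> phases f \<theta>" if "z \<in> phases f \<theta>" for z
      using that no_antipodal[OF assms] by (force simp: phases_eq)
  qed blast
  have "Re (u * term_value f a \<theta>) > 0" if "a \<in> Poly_Mapping.keys f" for a
  proof -
    have "u * term_value f a \<theta> = norm (term_value f a \<theta>) *\<^sub>R (u * sgn (term_value f a \<theta>))"
      using term_value_nonzero[OF that] by (simp add: sgn_div_norm)
    moreover have "Re (u * sgn (term_value f a \<theta>)) > 0"
      using u that by (simp add: phases_eq del: times_complex.sel)
    ultimately show ?thesis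
      using term_value_nonzero[OF that] by (simp del: times_complex.sel)
  qed
  then show thesis by (rule that)
qed

section \<open>The order map\<close>

lemma p_vec_eq:
  "p_vec f \<alpha> a \<theta> k = Arg (term_value f (\<alpha> k) \<theta> / term_value f a \<theta>)
    - Arg (Poly_Mapping.lookup f (\<alpha> k)) + Arg (Poly_Mapping.lookup f a)
    - (real_vec (\<alpha> k) - real_vec a) \<bullet> \<theta>"
proof -
  have "real_vec (\<alpha> k - a) = real_vec (\<alpha> k) - real_vec a"
    by (simp add: real_vec_def vec_eq_iff)
  then show ?thesis
    by (simp add: p_vec_def term_value_def)
qed

text \<open>\<open>p_vec\<close> is the difference of two arguments of the same quotient of terms:
  the principal one, and the one read off from coefficients and exponents.\<close>

lemma p_vec_int:
  assumes "a \<in> Poly_Mapping.keys f" "\<alpha> k \<in> Poly_Mapping.keys f"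
  obtains l :: int where "p_vec f \<alpha> a \<theta> k = 2 * pi * of_int l"
proof -
  let ?q = "term_value f (\<alpha> k) \<theta> / term_value f a \<theta>"
  have "cis (Arg ?q) = sgn ?q"
    using assms by (simp add: cis_Arg term_value_nonzero)
  also have "\<dots> = cis (Arg (Poly_Mapping.lookup f (\<alpha> k)) + real_vec (\<alpha> k) \<bullet> \<theta>
      - (Arg (Poly_Mapping.lookup f a) + real_vec a \<bullet> \<theta>))"
    using assms by (simp add: sgn_divide sgn_term_value cis_divide)
  finally have "cis (p_vec f \<alpha> a \<theta> k) = 1"
    unfolding p_vec_eq
    by (simp add: inner_diff_left algebra_simps flip: cis_divide cis_mult)
  then have "cos (p_vec f \<alpha> a \<theta> k) = 1"
    by (simp add: complex_eq_iff)
  then show thesis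
    using that by (auto simp: cos_one_2pi_int mult_ac)
qed

lemma dual_matrix_sum_rows:
  assumes "dual_matrix \<alpha> B"
  shows "(\<Sum>k\<in>UNIV. B k j) = 0" "(\<Sum>k\<in>UNIV. \<alpha> k $ i * B k j) = 0"
proof -
  have *: "(\<Sum>k\<in>UNIV. support_matrix \<alpha> $ r $ k * B k j) = 0" for r
  proof (cases "j < codim \<alpha>")
    case True
    then have "(support_matrix \<alpha> *v (\<chi> k. B k j)) $ r = 0"
      using assms by (simp add: dual_matrix_def)
    then show ?thesis by (simp add: matrix_vector_mult_def)
  next
    case False
    then show ?thesis using assms by (simp add: dual_matrix_def)
  qed
  show "(\<Sum>k\<in>UNIV. B k j) = 0"
    using *[of None] by (simp add: support_matrix_def)
  show "(\<Sum>k\<in>UNIV. \<alpha> k $ i * B k j) = 0"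
    using *[of "Some i"] by (simp add: support_matrix_def)
qed

lemma row_mult_add: "row_mult (\<lambda>k. x k + y k) B j = row_mult x B j + row_mult y B j"
  by (simp add: row_mult_def algebra_simps sum.distrib)

lemma row_mult_const:
  assumes "dual_matrix \<alpha> B"
  shows "row_mult (\<lambda>k. c) B j = 0"
proof -
  have "row_mult (\<lambda>k. c) B j = c * of_int (\<Sum>k\<in>UNIV. B k j)"
    by (simp add: row_mult_def sum_distrib_left)
  then show ?thesis using dual_matrix_sum_rows(1)[OF assms] by simp
qed

lemma row_mult_inner:
  assumes "dual_matrix \<alpha> B"
  shows "row_mult (\<lambda>k. real_vec (\<alpha> k) \<bullet> \<theta>) B j = 0"
proof -
  have "row_mult (\<lambda>k. real_vec (\<alpha> k) \<bullet> \<theta>) B j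
      = (\<Sum>k\<in>UNIV. \<Sum>i\<in>UNIV. \<theta> $ i * (real_of_int (\<alpha> k $ i) * real_of_int (B k j)))"
    by (simp add: row_mult_def inner_vec_def real_vec_def sum_distrib_left mult_ac)
  also have "\<dots> = (\<Sum>i\<in>UNIV. \<theta> $ i * of_int (\<Sum>k\<in>UNIV. \<alpha> k $ i * B k j))"
    by (subst sum.swap) (simp add: sum_distrib_left)
  finally show ?thesis using dual_matrix_sum_rows(2)[OF assms] by simp
qed

text \<open>\<open>B\<close> annihilates all summands except the arguments of the quotients. Hence
  \<open>v_vec\<close> depends on \<open>\<theta>\<close> only through
  \<open>torus_pt \<theta>\<close>.\<close>

lemma v_vec_eq:
  assumes "dual_matrix \<alpha> B"
  shows "v_vec f \<alpha> B a \<theta> = row_mult (\<lambda>k. Arg (term_value f (\<alpha> k) \<theta> / term_value f a \<theta>)) B"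
proof
  fix j
  have "v_vec f \<alpha> B a \<theta> j = row_mult (\<lambda>k. Arg (term_value f (\<alpha> k) \<theta> / term_value f a \<theta>)
      + ((Arg (Poly_Mapping.lookup f a) + real_vec a \<bullet> \<theta>) + real_vec (\<alpha> k) \<bullet> (- \<theta>))) B j"
    by (simp add: v_vec_def p_vec_eq Arg_vec_def inner_diff_left algebra_simps)
  also have "\<dots> = row_mult (\<lambda>k. Arg (term_value f (\<alpha> k) \<theta> / term_value f a \<theta>)) B j"
    unfolding row_mult_add row_mult_const[OF assms] row_mult_inner[OF assms] by simp
  finally show "v_vec f \<alpha> B a \<theta> j
      = row_mult (\<lambda>k. Arg (term_value f (\<alpha> k) \<theta> / term_value f a \<theta>)) B j" .
qed

lemma v_vec_eq_Arg_rotated: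
  assumes "dual_matrix \<alpha> B" "range \<alpha> \<subseteq> Poly_Mapping.keys f" "a \<in> Poly_Mapping.keys f"
    and u: "\<And>b. b \<in> Poly_Mapping.keys f \<Longrightarrow> Re (u * term_value f b \<theta>) > 0"
  shows "v_vec f \<alpha> B a \<theta> = row_mult (\<lambda>k. Arg (u * term_value f (\<alpha> k) \<theta>)) B"
proof
  fix j
  have "u \<noteq> 0" using u[OF assms(3)] by auto
  have "Arg (term_value f (\<alpha> k) \<theta> / term_value f a \<theta>)
      = Arg (u * term_value f (\<alpha> k) \<theta>) + (- Arg (u * term_value f a \<theta>))" for k
  proof -
    have "term_value f (\<alpha> k) \<theta> / term_value f a \<theta>
        = (u * term_value f (\<alpha> k) \<theta>) / (u * term_value f a \<theta>)"
      using \<open>u \<noteq> 0\<close> by simp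
    then show ?thesis
      using Arg_divide_Re_pos[OF u[of "\<alpha> k"] u[OF assms(3)]] assms(2) by auto
  qed
  then have "v_vec f \<alpha> B a \<theta> j = row_mult (\<lambda>k. Arg (u * term_value f (\<alpha> k) \<theta>)
      + (- Arg (u * term_value f a \<theta>))) B j"
    by (simp add: v_vec_eq[OF assms(1)])
  also have "\<dots> = row_mult (\<lambda>k. Arg (u * term_value f (\<alpha> k) \<theta>)) B j"
    unfolding row_mult_add using row_mult_const[OF assms(1)] by simp
  finally show "v_vec f \<alpha> B a \<theta> j = row_mult (\<lambda>k. Arg (u * term_value f (\<alpha> k) \<theta>)) B j" .
qed

lemma v_vec_in_shifted_lattice:
  fixes \<alpha> :: "'k::finite \<Rightarrow> int ^ 'n"
  assumes "range \<alpha> \<subseteq> Poly_Mapping.keys f" "a \<in> Poly_Mapping.keys f"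
  shows "v_vec f \<alpha> B a \<theta> \<in> shifted_lattice f \<alpha> B"
proof -
  have "\<forall>k. \<exists>l::int. p_vec f \<alpha> a \<theta> k = 2 * pi * of_int l"
    using assms by (metis p_vec_int rangeI subsetD)
  then obtain l :: "'k \<Rightarrow> int" where l: "\<And>k. p_vec f \<alpha> a \<theta> k = 2 * pi * of_int (l k)"
    by metis
  have "v_vec f \<alpha> B a \<theta> = (\<lambda>j. row_mult (Arg_vec f \<alpha>) B j
      + 2 * pi * real_of_int (\<Sum>k\<in>UNIV. l k * B k j))"
    unfolding v_vec_def by (rule ext, subst row_mult_add)
      (simp add: row_mult_def l sum_distrib_left mult_ac)
  moreover have "(\<lambda>j. \<Sum>k\<in>UNIV. l k * B k j) \<in> row_lattice B"
    unfolding row_lattice_def by blast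
  ultimately show ?thesis
    unfolding shifted_lattice_def mem_Collect_eq
    by (intro exI[of _ "\<lambda>j. \<Sum>k\<in>UNIV. l k * B k j"] conjI)
qed

section \<open>Interior points of the zonotope\<close>

text \<open>Full rank makes the columns of \<open>B\<close> independent, so they have dual linear
  functionals; \<open>C j\<close> lists the values of the \<open>j\<close>-th one on the standard
  basis.\<close>

lemma dual_matrix_left_inverse:
  assumes "dual_matrix \<alpha> B"
  obtains C :: "nat \<Rightarrow> 'k::finite \<Rightarrow> real"
  where "\<And>i j. i < codim \<alpha> \<Longrightarrow> j < codim \<alpha> \<Longrightarrow>
    (\<Sum>k\<in>UNIV. C j k * of_int (B k i)) = (if i = j then 1 else 0)"
proof -
  define col where "col j = (\<chi> k. real_of_int (B k j))" for j
  let ?m = "codim \<alpha>" and ?S = "col ` {..<codim \<alpha>}"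
  have dim: "dim ?S = ?m"
    using assms by (simp add: dual_matrix_def col_def[abs_def])
  \<comment> \<open>The rank is the dimension of a set of columns. Having \<open>?m\<close>
    elements, this set has no repeated column, so \<open>j\<close> can be recovered from
    \<open>col j\<close>.\<close>
  then have card: "card ?S = ?m"
    using dim_le_card'[of ?S] card_image_le[of "{..<?m}" col] by simp
  then have inj: "inj_on col {..<?m}"
    by (intro eq_card_imp_inj_on) simp_all
  have indep: "independent ?S"
    by (rule card_le_dim_spanning[of ?S ?S]) (simp_all only: subset_refl span_superset dim card
        finite_imageI finite_lessThan le_refl)
  have "\<exists>g. linear g \<and> (\<forall>i<?m. g (col i) = (if i = j then 1 else (0::real)))" if j: "j < ?m" for j
  proof -
    obtain g where g: "linear g" "\<forall>x\<in>?S. g x = (if x = col j then 1 else (0::real))"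
      using linear_independent_extend[OF indep, of "\<lambda>x. if x = col j then 1 else (0::real)"] by metis
    have "g (col i) = (if i = j then 1 else 0)" if "i < ?m" for i
      using g(2) that j inj_on_eq_iff[OF inj, of i j] by simp
    with g(1) show ?thesis by blast
  qed
  then obtain g where g: "\<And>j. j < ?m \<Longrightarrow> linear (g j)"
    "\<And>i j. i < ?m \<Longrightarrow> j < ?m \<Longrightarrow> g j (col i) = (if i = j then 1 else (0::real))"
    by metis
  have "(\<Sum>k\<in>UNIV. g j (axis k 1) * of_int (B k i)) = g j (col i)" if "j < ?m" for i j
  proof -
    have "col i = (\<Sum>k\<in>UNIV. of_int (B k i) *\<^sub>R axis k 1)"
      by (simp add: col_def vec_eq_iff axis_def if_distrib cong: if_cong)
    then have "g j (col i) = (\<Sum>k\<in>UNIV. of_int (B k i) *\<^sub>R g j (axis k 1))"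
      by (simp only: linear_sum[OF g(1)[OF that]] linear_cmul[OF g(1)[OF that]])
    then show ?thesis by (simp add: mult_ac)
  qed
  then show thesis
    using g(2) by (intro that[of "\<lambda>j k. g j (axis k 1)"]) simp
qed

text \<open>Points near \<open>row_mult t B\<close> lift continuously to coefficient vectors near
  \<open>t\<close>, which stay in the open cube of half-width \<open>pi / 2\<close>.\<close>

lemma row_mult_in_interior_zonotope:
  assumes B: "dual_matrix \<alpha> B" and t: "\<And>k. \<bar>t k\<bar> < pi / 2"
  shows "row_mult t B \<in> Euclidean_space (codim \<alpha>) interior_of zonotope B"
proof -
  let ?m = "codim \<alpha>"
  have Bz: "B k j = 0" if "j \<ge> ?m" for k j
    using B that by (simp add: dual_matrix_def)
  obtain C where C: "\<And>i j. i < ?m \<Longrightarrow> j < ?m \<Longrightarrow>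
      (\<Sum>k\<in>UNIV. C j k * of_int (B k i)) = (if i = j then 1 else (0::real))"
    using dual_matrix_left_inverse[OF B] by metis
  \<comment> \<open>An affine right inverse of \<open>row_mult\<close> on
    \<open>Euclidean_space ?m\<close>, translated so that it sends \<open>row_mult t B\<close> to
    \<open>t\<close>.\<close>
  define s where "s w k = t k + (\<Sum>j<?m. (w j - row_mult t B j) * C j k)" for w k
  define U where "U = (\<Inter>k. {w \<in> topspace (Euclidean_space ?m). s w k \<in> {- pi / 2 <..< pi / 2}})"
  have "openin (Euclidean_space ?m) {w \<in> topspace (Euclidean_space ?m). s w k \<in> {- pi / 2 <..< pi / 2}}"
    for k
  proof -
    have "continuous_map (Euclidean_space ?m) euclideanreal (\<lambda>w. w j)" for j
      unfolding Euclidean_space_def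
      by (intro continuous_map_from_subtopology continuous_map_product_projection) simp
    then have "continuous_map (Euclidean_space ?m) euclideanreal (\<lambda>w. s w k)"
      unfolding s_def by (intro continuous_intros) auto
    then show ?thesis
      by (rule openin_continuous_map_preimage) simp
  qed
  then have "openin (Euclidean_space ?m) U"
    unfolding U_def by (intro openin_INT2) auto
  moreover have "row_mult t B \<in> U"
  proof -
    have "s (row_mult t B) = t"
      by (simp add: s_def fun_eq_iff)
    moreover have "row_mult t B \<in> topspace (Euclidean_space ?m)"
      by (simp add: topspace_Euclidean_space row_mult_def Bz)
    moreover have "t k \<in> {- pi / 2 <..< pi / 2}" for k
      using t[of k] unfolding greaterThanLessThan_iff by linarith
    ultimately show ?thesis
      by (simp only: U_def INT_iff mem_Collect_eq simp_thms ball_simps)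
  qed
  moreover have "U \<subseteq> zonotope B"
  proof
    fix w assume w: "w \<in> U"
    have "w j = row_mult (s w) B j" for j
    \<comment> \<open>Below \<open>?m\<close> the left inverse \<open>C\<close> evaluates the
      correction term; from \<open>?m\<close> on both sides are 0.\<close>
    proof (cases "j < ?m")
      case True
      have "row_mult (s w) B j = row_mult t B j
          + (\<Sum>k\<in>UNIV. \<Sum>i<?m. (w i - row_mult t B i) * (C i k * of_int (B k j)))"
        unfolding s_def row_mult_add
        by (subst (3) row_mult_def) (simp add: sum_distrib_right mult.assoc)
      also have "(\<Sum>k\<in>UNIV. \<Sum>i<?m. (w i - row_mult t B i) * (C i k * of_int (B k j)))
          = (\<Sum>i<?m. (w i - row_mult t B i) * (if j = i then 1 else 0))"
        by (subst sum.swap) (use C True in \<open>simp flip: sum_distrib_left\<close>)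
      also have "\<dots> = w j - row_mult t B j"
        using True by (simp add: if_distrib cong: if_cong)
      finally show ?thesis by simp
    next
      case False
      then show ?thesis
        using w by (auto simp: U_def topspace_Euclidean_space row_mult_def Bz)
    qed
    then have "w = (\<lambda>j. \<Sum>k\<in>UNIV. pi / 2 * (s w k / (pi / 2)) * of_int (B k j))"
      by (simp add: row_mult_def fun_eq_iff)
    moreover have "\<bar>s w k / (pi / 2)\<bar> \<le> 1" for k
    proof -
      have "s w k \<in> {- pi / 2 <..< pi / 2}" using w unfolding U_def by blast
      then have "\<bar>s w k\<bar> < pi / 2" unfolding greaterThanLessThan_iff by linarith
      then show ?thesis by (simp add: abs_divide divide_le_eq)
    qed
    ultimately show "w \<in> zonotope B"
      unfolding zonotope_def mem_Collect_eq
      by (intro exI[of _ "\<lambda>k. s w k / (pi / 2)"] conjI allI)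
  qed
  ultimately show ?thesis
    unfolding interior_of_def by blast
qed

section \<open>Constancy on components\<close>

text \<open>The values lie in a set with gaps \<open>2 * pi\<close>, so continuity at
  \<open>\<theta>\<close> forces equality nearby.\<close>

lemma p_vec_locally_constant:
  assumes \<theta>: "torus_pt \<theta> \<notin> closure (lopsided_coamoeba f)"
    and keys: "a \<in> Poly_Mapping.keys f" "\<alpha> k \<in> Poly_Mapping.keys f"
  shows "\<forall>\<^sub>F \<theta>' in nhds \<theta>. p_vec f \<alpha> a \<theta>' k = p_vec f \<alpha> a \<theta> k"
proof -
  let ?q = "\<lambda>\<theta>. term_value f (\<alpha> k) \<theta> / term_value f a \<theta>"
  obtain u where u: "\<And>b. b \<in> Poly_Mapping.keys f \<Longrightarrow> Re (u * term_value f b \<theta>) > 0"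
    using open_half_plane[OF \<theta>] by blast
  \<comment> \<open>The branch cut of \<open>Arg\<close> is avoided: a nonpositive real quotient
    cannot relate two points of the same open half-plane.\<close>
  have "?q \<theta> \<notin> \<real>\<^sub>\<le>\<^sub>0"
  proof
    assume "?q \<theta> \<in> \<real>\<^sub>\<le>\<^sub>0"
    then obtain r where r: "?q \<theta> = complex_of_real r" "r \<le> 0"
      by (auto elim: nonpos_Reals_cases)
    then have "term_value f (\<alpha> k) \<theta> = r * term_value f a \<theta>"
      using term_value_nonzero[OF keys(1), of \<theta>] by (simp add: divide_eq_eq)
    then have "Re (u * term_value f (\<alpha> k) \<theta>) = r * Re (u * term_value f a \<theta>)"
      by (simp add: algebra_simps)
    then show False
      using u[OF keys(1)] u[OF keys(2)] r(2) by (simp add: mult_le_0_iff not_less[symmetric]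
          zero_less_mult_iff del: times_complex.sel)
  qed
  then have "isCont (\<lambda>\<theta>. Arg (?q \<theta>)) \<theta>"
    using keys by (intro isCont_o2[OF _ continuous_at_Arg] isCont_divide continuous_term_value
        term_value_nonzero)
  then have "isCont (\<lambda>\<theta>. p_vec f \<alpha> a \<theta> k) \<theta>"
    unfolding p_vec_eq by (intro continuous_intros)
  then have "\<forall>\<^sub>F \<theta>' in nhds \<theta>. dist (p_vec f \<alpha> a \<theta>' k) (p_vec f \<alpha> a \<theta> k) < 2 * pi"
    unfolding isCont_def by (intro tendstoD[OF iffD1[OF tendsto_at_iff_tendsto_nhds]]) simp_all
  then show ?thesis
  proof eventually_elim
    case (elim \<theta>')
    obtain l l' :: int where l: "p_vec f \<alpha> a \<theta> k = 2 * pi * of_int l"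
      "p_vec f \<alpha> a \<theta>' k = 2 * pi * of_int l'"
      using p_vec_int[of a f \<alpha> k, OF keys] by metis
    have "2 * pi * \<bar>of_int (l' - l)\<bar> < 2 * pi * 1"
      using elim by (simp add: l dist_real_def abs_mult flip: right_diff_distrib)
    then have "\<bar>l' - l\<bar> < 1"
      by (simp flip: of_int_abs of_int_diff)
    then show ?case by (simp add: l)
  qed
qed

lemma v_vec_constant_on_component:
  assumes "dual_matrix \<alpha> B" "range \<alpha> \<subseteq> Poly_Mapping.keys f" "a \<in> Poly_Mapping.keys f"
    and \<Theta>: "\<Theta> \<in> CC f" "torus_pt \<theta> \<in> \<Theta>" "torus_pt \<theta>' \<in> \<Theta>"
  shows "v_vec f \<alpha> B a \<theta> = v_vec f \<alpha> B a \<theta>'"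
proof -
  \<comment> \<open>The argument runs on the torus, where \<open>\<Theta>\<close> is connected; its
    preimage in \<open>real ^ 'n\<close> need not be. The choice of lift is immaterial since the
    term values agree.\<close>
  define g where "g x = v_vec f \<alpha> B a (inv torus_pt x)" for x
  have g: "g (torus_pt \<theta>) = v_vec f \<alpha> B a \<theta>" for \<theta>
    using term_value_cong[of "inv torus_pt (torus_pt \<theta>)" \<theta> f]
    by (simp add: g_def v_vec_eq[OF assms(1)] surj_f_inv_f[OF surj_torus_pt])
  have "connected \<Theta>"
    using \<Theta>(1) by (auto simp: CC_def in_components_connected)
  moreover have "\<forall>\<^sub>F y in at x within \<Theta>. g x = g y" if "x \<in> \<Theta>" for x
  proof -
    obtain \<eta> where \<eta>: "x = torus_pt \<eta>"
      using surj_torus_pt by blast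
    have "torus_pt \<eta> \<notin> closure (lopsided_coamoeba f)"
      using \<Theta>(1) that in_components_subset unfolding CC_def \<eta> by blast
    then have "\<forall>k\<in>UNIV. \<forall>\<^sub>F \<eta>' in nhds \<eta>. p_vec f \<alpha> a \<eta>' k = p_vec f \<alpha> a \<eta> k"
      by (intro ballI p_vec_locally_constant assms(3) range_subsetD[OF assms(2)])
    then have "\<forall>\<^sub>F \<eta>' in nhds \<eta>. \<forall>k\<in>UNIV. p_vec f \<alpha> a \<eta>' k = p_vec f \<alpha> a \<eta> k"
      by (rule eventually_ball_finite[OF finite])
    then obtain U where U: "open U" "\<eta> \<in> U" "\<And>\<eta>' k. \<eta>' \<in> U \<Longrightarrow> p_vec f \<alpha> a \<eta>' k = p_vec f \<alpha> a \<eta> k"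
      unfolding eventually_nhds by auto
    have "g x = g y" if "y \<in> torus_pt ` U" for y
      using that U(3) by (auto simp: g \<eta> v_vec_def)
    moreover have "open (torus_pt ` U)" "x \<in> torus_pt ` U"
      using U(1,2) by (auto simp: open_image_torus_pt \<eta>)
    ultimately show ?thesis
      unfolding eventually_at_topological by blast
  qed
  ultimately have "g (torus_pt \<theta>) = g (torus_pt \<theta>')"
    using connected_local_const[of \<Theta> _ _ g] \<Theta>(2,3) by blast
  then show ?thesis by (simp add: g)
qed

theorem theorem4p3:
  fixes f :: "(int ^ 'n) \<Rightarrow>\<^sub>0 complex"
    and \<alpha> :: "'k::finite \<Rightarrow> int ^ 'n"
    and B :: "'k \<Rightarrow> nat \<Rightarrow> int"
  assumes "bij_betw \<alpha> UNIV (Poly_Mapping.keys f)"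
    and "aff_dim (newton_polytope f) = int CARD('n)"
    and "dual_matrix \<alpha> B"
  shows "\<exists>!coord. coord \<in> CC f \<rightarrow>\<^sub>E
            (Euclidean_space (codim \<alpha>) interior_of zonotope B) \<inter> shifted_lattice f \<alpha> B \<and>
          (\<forall>\<Theta>\<in>CC f. \<forall>\<theta>. torus_pt \<theta> \<in> \<Theta> \<longrightarrow>
            (\<forall>a\<in>Poly_Mapping.keys f. coord \<Theta> = v_vec f \<alpha> B a \<theta>))"
proof -
  let ?K = "Poly_Mapping.keys f"
  let ?T = "(Euclidean_space (codim \<alpha>) interior_of zonotope B) \<inter> shifted_lattice f \<alpha> B"
  have range: "range \<alpha> \<subseteq> ?K"
    using assms(1) by (simp add: bij_betw_def)
  obtain a where a: "a \<in> ?K"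
    using range by blast
  have "\<exists>\<theta>. torus_pt \<theta> \<in> \<Theta>" if "\<Theta> \<in> CC f" for \<Theta>
    using that in_components_nonempty surj_torus_pt unfolding CC_def by (metis ex_in_conv surjD)
  then obtain \<tau> where \<tau>: "\<And>\<Theta>. \<Theta> \<in> CC f \<Longrightarrow> torus_pt (\<tau> \<Theta>) \<in> \<Theta>"
    by metis
  have half_plane: "\<exists>u. \<forall>b\<in>?K. Re (u * term_value f b \<theta>) > 0" if "\<Theta> \<in> CC f" "torus_pt \<theta> \<in> \<Theta>" for \<Theta> \<theta>
  proof -
    have "torus_pt \<theta> \<notin> closure (lopsided_coamoeba f)"
      using that in_components_subset unfolding CC_def by blast
    then show ?thesis
      using open_half_plane by metis
  qed
  have target: "v_vec f \<alpha> B a (\<tau> \<Theta>) \<in> ?T" if \<Theta>: "\<Theta> \<in> CC f" for \<Theta>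
  proof -
    obtain u where u: "\<And>b. b \<in> ?K \<Longrightarrow> Re (u * term_value f b (\<tau> \<Theta>)) > 0"
      using half_plane[OF \<Theta> \<tau>[OF \<Theta>]] by blast
    have "\<bar>Arg (u * term_value f (\<alpha> k) (\<tau> \<Theta>))\<bar> < pi / 2" for k
    proof -
      have "Re (u * term_value f (\<alpha> k) (\<tau> \<Theta>)) > 0"
        using range by (intro u) blast
      then show ?thesis
        by (metis Arg_eq_Im_Ln Re_Ln_pos_lt less_irrefl zero_complex.sel(1))
    qed
    then show ?thesis
      using row_mult_in_interior_zonotope[OF assms(3)] v_vec_in_shifted_lattice[OF range a]
        v_vec_eq_Arg_rotated[OF assms(3) range a u] by (metis IntI)
  qed
  \<comment> \<open>First the point moves within \<open>\<Theta>\<close> with \<open>a\<close>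
    fixed, then the exponent changes at the fixed point \<open>\<theta>\<close>.\<close>
  have indep: "v_vec f \<alpha> B a (\<tau> \<Theta>) = v_vec f \<alpha> B b \<theta>"
    if \<Theta>: "\<Theta> \<in> CC f" and \<theta>: "torus_pt \<theta> \<in> \<Theta>" and b: "b \<in> ?K" for \<Theta> \<theta> b
  proof -
    obtain u where u: "\<And>b. b \<in> ?K \<Longrightarrow> Re (u * term_value f b \<theta>) > 0"
      using half_plane[OF \<Theta> \<theta>] by blast
    have "v_vec f \<alpha> B a (\<tau> \<Theta>) = v_vec f \<alpha> B a \<theta>"
      using v_vec_constant_on_component[OF assms(3) range a \<Theta> \<tau>[OF \<Theta>] \<theta>] .
    also have "\<dots> = v_vec f \<alpha> B b \<theta>"
      using v_vec_eq_Arg_rotated[OF assms(3) range _ u] a b by simp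
    finally show ?thesis .
  qed
  show ?thesis
  proof (rule ex1I[of _ "\<lambda>\<Theta>\<in>CC f. v_vec f \<alpha> B a (\<tau> \<Theta>)"], intro conjI)
    show "(\<lambda>\<Theta>\<in>CC f. v_vec f \<alpha> B a (\<tau> \<Theta>)) \<in> CC f \<rightarrow>\<^sub>E ?T"
      using target by (intro PiE_I) simp_all
    show "\<forall>\<Theta>\<in>CC f. \<forall>\<theta>. torus_pt \<theta> \<in> \<Theta> \<longrightarrow>
        (\<forall>b\<in>?K. (\<lambda>\<Theta>\<in>CC f. v_vec f \<alpha> B a (\<tau> \<Theta>)) \<Theta> = v_vec f \<alpha> B b \<theta>)"
      using indep by simp
    fix h
    assume h: "h \<in> CC f \<rightarrow>\<^sub>E ?T \<and> (\<forall>\<Theta>\<in>CC f. \<forall>\<theta>. torus_pt \<theta> \<in> \<Theta> \<longrightarrow>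
        (\<forall>b\<in>?K. h \<Theta> = v_vec f \<alpha> B b \<theta>))"
    \<comment> \<open>On \<open>CC f\<close> the value is forced at the lift
      \<open>\<tau> \<Theta>\<close>; elsewhere both functions are \<open>undefined\<close> by
      extensionality.\<close>
    show "h = (\<lambda>\<Theta>\<in>CC f. v_vec f \<alpha> B a (\<tau> \<Theta>))"
    proof
      show "h \<Theta> = (\<lambda>\<Theta>\<in>CC f. v_vec f \<alpha> B a (\<tau> \<Theta>)) \<Theta>" for \<Theta>
        using h a \<tau> by (cases "\<Theta> \<in> CC f") auto
    qed
  qed
qed

end
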